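(* Let $\kappa_{\rm sf}\ge\kappa>0$, $D_{\rm st}>D_{\rm sf}$, $a_{\min}>0$, $\bar v>0$, let $\Phi$ be a finite set of integers $k>1$, and let $\xi>0$ satisfy $1/\xi>\kappa_{\rm sf}$. Set $\gamma=\dfrac{1-\xi\kappa_{\rm sf}}{2\xi}$. Safe control gains (as defined in the context) exist only if $$\xi\le \xi_{\rm cr}=\frac{1}{\kappa_{\rm sf}+2\sqrt{\dfrac{\kappa_{\rm sf}a_{\min}}{\kappa(D_{\rm st}-D_{\rm sf})}}}.$$ That is, if there exist safe control gains $A$, $B_1$, $B_k$ ($k\in\Phi$), then $\xi\le\xi_{\rm cr}$.
   Context: Safe control gains are real numbers $A\ge 0$, $B_1\ge 0$, $B_k\ge 0$ ($k\in\Phi$) satisfying both inequalities $$A\le \frac{(1-\xi\kappa_{\rm sf})^2}{4\xi}-\xi\Big(\gamma-\frac{1-\xi\kappa_{\rm sf}}{2\xi}\Big)^2,$$ $$A\ge \frac{\big(|\kappa_{\rm sf}-\xi\kappa_{\rm sf}^2-B_1|+\sum_{k\in\Phi}B_k\big)\bar v+\xi\kappa_{\rm sf}a_{\min}}{\kappa(D_{\rm st}-D_{\rm sf})}.$$ (These are the sufficient safety conditions for a connected cruise controller with gains $A,B_1,B_k$ acting on a vehicle with first-order lag $\xi$, distance parameters $D_{\rm st},D_{\rm sf}$, range policy gradient $\kappa$, inverse time headway $\kappa_{\rm sf}$, speed difference bound $\bar v$, and maximum deceleration $a_{\min}$ of the vehicle ahead.) *)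

theory Defs
  imports Complex_Main
begin

text \<open>
  The gains \<open>B\<^sub>k\<close> for \<open>k \<in> \<Phi>\<close> are given by a function \<open>B\<close> of which only
  the values on \<open>\<Phi>\<close> matter; \<open>B1\<close> is the separate gain \<open>B\<^sub>1\<close>.
\<close>

definition safe_control_gains ::
  "real \<Rightarrow> real \<Rightarrow> real \<Rightarrow> real \<Rightarrow> real \<Rightarrow> real \<Rightarrow> real \<Rightarrow> real \<Rightarrow> int set
    \<Rightarrow> real \<Rightarrow> real \<Rightarrow> (int \<Rightarrow> real) \<Rightarrow> bool"
where
  "safe_control_gains \<kappa> \<kappa>\<^sub>s\<^sub>f D\<^sub>s\<^sub>t D\<^sub>s\<^sub>f a_min v_bar \<xi> \<gamma> \<Phi> A B1 B \<longleftrightarrow>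
     A \<ge> 0 \<and> B1 \<ge> 0 \<and> (\<forall>k\<in>\<Phi>. B k \<ge> 0) \<and>
     A \<le> (1 - \<xi> * \<kappa>\<^sub>s\<^sub>f)\<^sup>2 / (4 * \<xi>) - \<xi> * (\<gamma> - (1 - \<xi> * \<kappa>\<^sub>s\<^sub>f) / (2 * \<xi>))\<^sup>2 \<and>
     A \<ge> ((\<bar>\<kappa>\<^sub>s\<^sub>f - \<xi> * \<kappa>\<^sub>s\<^sub>f\<^sup>2 - B1\<bar> + (\<Sum>k\<in>\<Phi>. B k)) * v_bar + \<xi> * \<kappa>\<^sub>s\<^sub>f * a_min)
           / (\<kappa> * (D\<^sub>s\<^sub>t - D\<^sub>s\<^sub>f))"

definition \<xi>_cr :: "real \<Rightarrow> real \<Rightarrow> real \<Rightarrow> real \<Rightarrow> real \<Rightarrow> real" where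
  "\<xi>_cr \<kappa> \<kappa>\<^sub>s\<^sub>f D\<^sub>s\<^sub>t D\<^sub>s\<^sub>f a_min =
     1 / (\<kappa>\<^sub>s\<^sub>f + 2 * sqrt (\<kappa>\<^sub>s\<^sub>f * a_min / (\<kappa> * (D\<^sub>s\<^sub>t - D\<^sub>s\<^sub>f))))"

end

theory Submission
  imports Defs
begin

text \<open>
  For this \<open>\<gamma>\<close> the square in the upper bound vanishes, and the gains
  contribute a nonnegative term to the lower bound. With
  \<open>M = \<kappa>\<^sub>s\<^sub>f a_min / (\<kappa> (D\<^sub>s\<^sub>t - D\<^sub>s\<^sub>f))\<close> the two bounds are therefore compatible only if
  \<open>\<xi> M \<le> (1 - \<xi> \<kappa>\<^sub>s\<^sub>f)\<^sup>2 / (4 \<xi>)\<close>; taking square roots, with \<open>1 - \<xi> \<kappa>\<^sub>s\<^sub>f > 0\<close>, gives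
  \<open>\<xi> (\<kappa>\<^sub>s\<^sub>f + 2 sqrt M) \<le> 1\<close>.
\<close>

theorem corollary3:
  fixes \<kappa> \<kappa>\<^sub>s\<^sub>f D\<^sub>s\<^sub>t D\<^sub>s\<^sub>f a_min v_bar \<xi> \<gamma> :: real and \<Phi> :: "int set"
  assumes "\<kappa>\<^sub>s\<^sub>f \<ge> \<kappa>" and "\<kappa> > 0"
    and "D\<^sub>s\<^sub>t > D\<^sub>s\<^sub>f" and "a_min > 0" and "v_bar > 0"
    and "finite \<Phi>" and "\<forall>k\<in>\<Phi>. k > 1"
    and "\<xi> > 0" and "1 / \<xi> > \<kappa>\<^sub>s\<^sub>f"
    and "\<gamma> = (1 - \<xi> * \<kappa>\<^sub>s\<^sub>f) / (2 * \<xi>)"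
    and "\<exists>A B1 B. safe_control_gains \<kappa> \<kappa>\<^sub>s\<^sub>f D\<^sub>s\<^sub>t D\<^sub>s\<^sub>f a_min v_bar \<xi> \<gamma> \<Phi> A B1 B"
  shows "\<xi> \<le> \<xi>_cr \<kappa> \<kappa>\<^sub>s\<^sub>f D\<^sub>s\<^sub>t D\<^sub>s\<^sub>f a_min"
proof -
  define d where "d = \<kappa> * (D\<^sub>s\<^sub>t - D\<^sub>s\<^sub>f)"
  define M where "M = \<kappa>\<^sub>s\<^sub>f * a_min / d"
  define u where "u = 1 - \<xi> * \<kappa>\<^sub>s\<^sub>f"
  have d: "d > 0" using assms(2,3) by (simp add: d_def)
  have ksf: "\<kappa>\<^sub>s\<^sub>f > 0" using assms(1,2) by linarith
  have M: "M > 0" using d ksf assms(4) by (simp add: M_def)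
  have u: "u > 0" using assms(8,9) by (simp add: u_def field_simps)
  obtain A B1 B where B: "\<forall>k\<in>\<Phi>. B k \<ge> 0"
    and upper: "A \<le> u\<^sup>2 / (4 * \<xi>)"
    and lower: "((\<bar>\<kappa>\<^sub>s\<^sub>f - \<xi> * \<kappa>\<^sub>s\<^sub>f\<^sup>2 - B1\<bar> + (\<Sum>k\<in>\<Phi>. B k)) * v_bar + \<xi> * \<kappa>\<^sub>s\<^sub>f * a_min) / d \<le> A"
    using assms(10,11) unfolding safe_control_gains_def d_def u_def by auto
  \<comment> \<open>Whatever the value of \<open>B1\<close>, no choice of gains can push the lower
    bound on \<open>A\<close> below its \<open>a_min\<close> term.\<close>
  have "0 \<le> (\<bar>\<kappa>\<^sub>s\<^sub>f - \<xi> * \<kappa>\<^sub>s\<^sub>f\<^sup>2 - B1\<bar> + (\<Sum>k\<in>\<Phi>. B k)) * v_bar"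
    using B assms(5) by (simp add: sum_nonneg)
  then have "\<xi> * \<kappa>\<^sub>s\<^sub>f * a_min / d \<le> A"
    using lower d by (smt (verit) divide_right_mono)
  with upper have "\<xi> * M \<le> u\<^sup>2 / (4 * \<xi>)"
    by (simp add: M_def mult.assoc)
  then have "4 * \<xi>\<^sup>2 * M \<le> u\<^sup>2"
    using assms(8) by (simp add: field_simps power2_eq_square)
  then have "(2 * \<xi> * sqrt M)\<^sup>2 \<le> u\<^sup>2"
    using M by (simp add: power_mult_distrib)
  \<comment> \<open>The squares may be dropped because \<open>u\<close> is positive, which is where
    \<open>1 / \<xi> > \<kappa>\<^sub>s\<^sub>f\<close> enters.\<close>
  then have "2 * \<xi> * sqrt M \<le> u"
    using u by (auto intro: power2_le_imp_le)
  then have "\<xi> * (\<kappa>\<^sub>s\<^sub>f + 2 * sqrt M) \<le> 1"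
    by (simp add: u_def algebra_simps)
  \<comment> \<open>This is the denominator of \<open>\<xi>_cr\<close>; its sign allows dividing the
    product bound by it.\<close>
  moreover have "\<kappa>\<^sub>s\<^sub>f + 2 * sqrt M > 0"
    using ksf M by (simp add: add_pos_pos)
  ultimately show ?thesis
    unfolding \<xi>_cr_def d_def[symmetric] M_def[symmetric] by (simp add: pos_le_divide_eq)
qed

end
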